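(* Let $Q\in\mathbb{R}^{n\times n}$ be symmetric, $f\in\mathbb{R}^n$ and $r>0$. Let $\lambda_1=\cdots=\lambda_k<\lambda_{k+1}\le\cdots\le\lambda_n$ be the eigenvalues of $Q$ (so $k$ is the multiplicity of the smallest eigenvalue), let $Q=U\Lambda U^T$ with $U$ orthogonal and $\Lambda=\mathrm{diag}(\lambda_1,\ldots,\lambda_n)$, and let $\hat f=U^Tf=(\hat f_1,\ldots,\hat f_n)^T$. Suppose that the problem $$(\mathcal P)\qquad \min\{\,P(x)=x^TQx-2f^Tx \;:\; x\in\mathbb{R}^n,\ \|x\|\le r\,\}$$ has a solution (global minimizer) on the boundary $\{x:\|x\|=r\}$ of its feasible set. Let $$P^d(\sigma)=-f^T(Q+\sigma I)^{-1}f-r^2\sigma .$$ Then there exists a critical point of $P^d$ in $(-\lambda_1,+\infty)$ if and only if either $$\sum_{i=1}^k\hat f_i^2\neq 0\qquad\text{or}\qquad \sum_{i=k+1}^n\frac{\hat f_i^2}{(\lambda_i-\lambda_1)^2}>r^2 .$$ Moreover, if $P^d$ has a critical point $\bar\sigma$ in $(-\lambda_1,+\infty)$, then this critical point is unique in $(-\lambda_1,+\infty)$ and $\bar x=(Q+\bar\sigma I)^{-1}f$ is a global solution of the problem $(\mathcal P)$.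
   Context: $\|\cdot\|$ is the Euclidean norm and $I$ is the $n\times n$ identity matrix. For $\sigma>-\lambda_1$ the matrix $Q+\sigma I$ is invertible, so $P^d$ (the canonical dual function of $(\mathcal P)$) is well defined and differentiable on $(-\lambda_1,+\infty)$. In terms of the eigenvalues it reads $$P^d(\sigma)=-\frac{\sum_{i=1}^k\hat f_i^2}{\lambda_1+\sigma}-\sum_{i=k+1}^n\frac{\hat f_i^2}{\lambda_i+\sigma}-r^2\sigma .$$ A critical point of $P^d$ is a $\sigma$ with $(P^d)'(\sigma)=0$. The "or" in the condition is inclusive. If $k=n$, sums over $i=k+1,\ldots,n$ are empty and equal $0$. *)

theory Defs
  imports "HOL-Analysis.Analysis"
begin

definition primal :: "real ^ 'n ^ 'n \<Rightarrow> real ^ 'n \<Rightarrow> real ^ 'n \<Rightarrow> real" where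
  "primal Q f x = x \<bullet> (Q *v x) - 2 * (f \<bullet> x)"

definition global_solution ::
    "real ^ 'n ^ 'n \<Rightarrow> real ^ 'n \<Rightarrow> real \<Rightarrow> real ^ 'n \<Rightarrow> bool" where
  "global_solution Q f r x \<longleftrightarrow> is_arg_min (primal Q f) (\<lambda>y. norm y \<le> r) x"

text \<open>Where \<open>Q + \<sigma> I\<close> is singular, \<^const>\<open>matrix_inv\<close> is unspecified; the dual function
  is only meaningful off the spectrum of \<open>- Q\<close>, in particular to the right of minus the smallest
  eigenvalue of \<open>Q\<close>.\<close>

definition dual :: "real ^ 'n ^ 'n \<Rightarrow> real ^ 'n \<Rightarrow> real \<Rightarrow> real \<Rightarrow> real" where
  "dual Q f r \<sigma> = - (f \<bullet> (matrix_inv (Q + \<sigma> *\<^sub>R mat 1) *v f)) - r\<^sup>2 * \<sigma>"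

definition critical_point :: "(real \<Rightarrow> real) \<Rightarrow> real \<Rightarrow> bool" where
  "critical_point \<phi> \<sigma> \<longleftrightarrow> (\<phi> has_real_derivative 0) (at \<sigma>)"

text \<open>The index type \<open>'n\<close> carries no order, so an enumeration \<open>ix\<close> of it, bijective
  from \<open>{1..CARD('n)}\<close>, names the coordinates \<open>1, \<dots>, n\<close>. The diagonal entry in row
  \<open>ix i\<close> is \<open>d i\<close>.\<close>

definition diag_mat :: "(nat \<Rightarrow> 'n::finite) \<Rightarrow> (nat \<Rightarrow> real) \<Rightarrow> real ^ 'n ^ 'n" where
  "diag_mat ix d = (\<chi> a b. if a = b then d (inv_into {1..CARD('n)} ix a) else 0)"

end

theory Submission
  imports Defs
begin

text \<open>
  With \<open>c\<^sub>i = fhat\<^sub>i\<^sup>2\<close>, the derivative of the dual at \<open>\<sigma>\<close> is the secular function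
  \<open>\<Sum> c\<^sub>i / (lam\<^sub>i + \<sigma>)\<^sup>2\<close>, which equals \<open>norm\<^sup>2\<close> of \<open>(Q + \<sigma> I)\<^sup>-\<^sup>1 f\<close>, minus \<open>r\<^sup>2\<close>.
  To the right of \<open>- lam\<^sub>1\<close>, and unless \<open>f = 0\<close>, the secular function is strictly decreasing with limit \<open>0\<close> at
  infinity, so it attains \<open>r\<^sup>2\<close>, and then only once, iff its supremum, the limit at \<open>- lam\<^sub>1\<close>,
  exceeds \<open>r\<^sup>2\<close>. At a critical point, \<open>xbar = (Q + \<sigma> I)\<^sup>-\<^sup>1 f\<close> has norm \<open>r\<close> and minimizes the
  convex function \<open>P + \<sigma> norm\<^sup>2\<close>; hence it minimizes \<open>P\<close> on the sphere of radius \<open>r\<close>, where a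
  global minimizer is assumed to lie. The sign of \<open>\<sigma>\<close> plays no role.
\<close>

section \<open>Diagonal matrices and orthogonal conjugation\<close>

lemma diag_mat_mult_vec_nth:
  fixes ix :: "nat \<Rightarrow> 'n::finite"
  assumes "bij_betw ix {1..CARD('n)} UNIV" "i \<in> {1..CARD('n)}"
  shows "(diag_mat ix d *v v) $ ix i = d i * v $ ix i"
proof -
  have "inv_into {1..CARD('n)} ix (ix i) = i"
    using assms by (simp add: bij_betw_inv_into_left)
  then show ?thesis
    by (simp add: diag_mat_def matrix_vector_mult_def if_distrib [where f = "\<lambda>x. x * _"] cong: if_cong)
qed

lemma inner_reindex:
  fixes ix :: "nat \<Rightarrow> 'n::finite" and u v :: "real ^ 'n"
  assumes "bij_betw ix {1..CARD('n)} UNIV"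
  shows "u \<bullet> v = (\<Sum>i=1..CARD('n). u $ ix i * v $ ix i)"
  using sum.reindex_bij_betw [OF assms, of "\<lambda>a. u $ a * v $ a"] by (simp add: inner_vec_def)

lemma diag_mat_mult:
  "diag_mat ix d ** diag_mat ix e = diag_mat ix (\<lambda>i. d i * e i)"
  by (simp add: diag_mat_def matrix_matrix_mult_def vec_eq_iff
      if_distrib [where f = "\<lambda>x. x * _"] cong: if_cong)

lemma diag_mat_shift:
  "diag_mat ix d + \<sigma> *\<^sub>R mat 1 = diag_mat ix (\<lambda>i. d i + \<sigma>)"
  by (simp add: diag_mat_def mat_def vec_eq_iff)

lemma diag_mat_eq_mat_1:
  fixes ix :: "nat \<Rightarrow> 'n::finite"
  assumes "bij_betw ix {1..CARD('n)} UNIV" "\<And>i. i \<in> {1..CARD('n)} \<Longrightarrow> d i = 1"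
  shows "diag_mat ix d = mat 1"
proof -
  have "inv_into {1..CARD('n)} ix a \<in> {1..CARD('n)}" for a
    using assms(1) by (intro inv_into_into) (auto simp: bij_betw_def)
  then show ?thesis
    using assms(2) by (simp add: diag_mat_def mat_def vec_eq_iff)
qed

lemma orthogonal_conj_mult:
  fixes U A B :: "real ^ 'n ^ 'n"
  assumes "orthogonal_matrix U"
  shows "(U ** A ** transpose U) ** (U ** B ** transpose U) = U ** (A ** B) ** transpose U"
proof -
  have "transpose U ** (U ** M) = M" for M :: "real ^ 'n ^ 'n"
    using assms by (simp add: matrix_mul_assoc orthogonal_matrix)
  then show ?thesis
    by (simp add: matrix_mul_assoc [symmetric])
qed

lemma matrix_add_rdistrib:
  fixes A B :: "'a::semiring_1 ^ 'n ^ 'm"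
  shows "(A + B) ** C = A ** C + B ** C"
  by (simp add: matrix_matrix_mult_def vec_eq_iff sum.distrib distrib_right)

lemma orthogonal_conj_shift:
  fixes U A :: "real ^ 'n ^ 'n"
  assumes "orthogonal_matrix U"
  shows "U ** A ** transpose U + \<sigma> *\<^sub>R mat 1 = U ** (A + \<sigma> *\<^sub>R mat 1) ** transpose U"
proof -
  have "U ** transpose U = mat 1"
    using assms by (simp add: orthogonal_matrix_def)
  then show ?thesis
    by (simp add: matrix_add_ldistrib matrix_add_rdistrib scalar_matrix_assoc [symmetric]
        matrix_scalar_ac)
qed

text \<open>\<open>matrix_inv\<close> is a choice among two-sided inverses. \<open>B\<close>
  witnesses that one exists, so the chosen matrix is a right inverse of \<open>A\<close>, and
  multiplying by \<open>B\<close> on the left identifies it with \<open>B\<close>.\<close>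

lemma matrix_inv_eqI:
  fixes A B :: "'a::field ^ 'n ^ 'n"
  assumes "A ** B = mat 1" "B ** A = mat 1"
  shows "matrix_inv A = B"
proof -
  have "A ** matrix_inv A = mat 1"
    using someI [of "\<lambda>A'. A ** A' = mat 1 \<and> A' ** A = mat 1" B] assms
    unfolding matrix_inv_def by blast
  then show ?thesis
    by (metis assms(2) matrix_mul_assoc matrix_mul_lid matrix_mul_rid)
qed

section \<open>Quadratic forms, norms and inverses in eigenvector coordinates\<close>

lemma inner_spectral:
  fixes U :: "real ^ 'n ^ 'n" and ix :: "nat \<Rightarrow> 'n"
  assumes "bij_betw ix {1..CARD('n)} UNIV"
  shows "v \<bullet> (U ** diag_mat ix d ** transpose U *v v) =
    (\<Sum>i=1..CARD('n). d i * ((transpose U *v v) $ ix i)\<^sup>2)"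
proof -
  have "v \<bullet> (U ** diag_mat ix d ** transpose U *v v) =
      (transpose U *v v) \<bullet> (diag_mat ix d *v (transpose U *v v))"
    by (simp add: matrix_vector_mul_assoc [symmetric] dot_lmul_matrix [symmetric])
  also have "\<dots> = (\<Sum>i=1..CARD('n). d i * ((transpose U *v v) $ ix i)\<^sup>2)"
    unfolding inner_reindex [OF assms]
    by (intro sum.cong) (simp_all only: diag_mat_mult_vec_nth [OF assms] power2_eq_square mult_ac)
  finally show ?thesis .
qed

lemma norm_spectral:
  fixes U :: "real ^ 'n ^ 'n" and ix :: "nat \<Rightarrow> 'n"
  assumes "bij_betw ix {1..CARD('n)} UNIV" "orthogonal_matrix U"
  shows "(norm (U ** diag_mat ix d ** transpose U *v v))\<^sup>2 =
    (\<Sum>i=1..CARD('n). (d i)\<^sup>2 * ((transpose U *v v) $ ix i)\<^sup>2)"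
proof -
  have "norm (U ** diag_mat ix d ** transpose U *v v) = norm (diag_mat ix d *v (transpose U *v v))"
    using assms(2) orthogonal_transformation_matrix [of "(*v) U"]
    by (simp add: matrix_vector_mul_assoc [symmetric] orthogonal_transformation)
  then have "(norm (U ** diag_mat ix d ** transpose U *v v))\<^sup>2 =
      (diag_mat ix d *v (transpose U *v v)) \<bullet> (diag_mat ix d *v (transpose U *v v))"
    by (simp add: power2_norm_eq_inner)
  also have "\<dots> = (\<Sum>i=1..CARD('n). (d i)\<^sup>2 * ((transpose U *v v) $ ix i)\<^sup>2)"
    unfolding inner_reindex [OF assms(1)]
    by (intro sum.cong) (simp_all only: diag_mat_mult_vec_nth [OF assms(1)] power2_eq_square mult_ac)
  finally show ?thesis .
qed

text \<open>The shift passes through the conjugation by \<open>U\<close>, and conjugates multiply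
  like their diagonal parts, so inverting amounts to inverting each shifted eigenvalue.\<close>

lemma spectral_shift_inv:
  fixes U :: "real ^ 'n ^ 'n" and ix :: "nat \<Rightarrow> 'n"
  assumes bij: "bij_betw ix {1..CARD('n)} UNIV" and U: "orthogonal_matrix U"
    and Q: "Q = U ** diag_mat ix lam ** transpose U"
    and nz: "\<And>i. i \<in> {1..CARD('n)} \<Longrightarrow> lam i + \<sigma> \<noteq> 0"
  defines "B \<equiv> U ** diag_mat ix (\<lambda>i. inverse (lam i + \<sigma>)) ** transpose U"
  shows "(Q + \<sigma> *\<^sub>R mat 1) ** B = mat 1" "matrix_inv (Q + \<sigma> *\<^sub>R mat 1) = B"
proof -
  have A: "Q + \<sigma> *\<^sub>R mat 1 = U ** diag_mat ix (\<lambda>i. lam i + \<sigma>) ** transpose U"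
    by (simp add: Q orthogonal_conj_shift [OF U] diag_mat_shift)
  have "diag_mat ix (\<lambda>i. (lam i + \<sigma>) * inverse (lam i + \<sigma>)) = mat 1"
    "diag_mat ix (\<lambda>i. inverse (lam i + \<sigma>) * (lam i + \<sigma>)) = mat 1"
    using nz by (auto intro!: diag_mat_eq_mat_1 [OF bij])
  moreover have "U ** transpose U = mat 1"
    using U by (simp add: orthogonal_matrix_def)
  ultimately have "(Q + \<sigma> *\<^sub>R mat 1) ** B = mat 1" "B ** (Q + \<sigma> *\<^sub>R mat 1) = mat 1"
    by (simp_all add: A B_def orthogonal_conj_mult [OF U] diag_mat_mult)
  then show "(Q + \<sigma> *\<^sub>R mat 1) ** B = mat 1" "matrix_inv (Q + \<sigma> *\<^sub>R mat 1) = B"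
    by (auto intro: matrix_inv_eqI)
qed

text \<open>Expansion of the quadratic \<open>P + \<sigma> norm\<^sup>2\<close> around its
  stationary point \<open>x\<close>: the gradient \<open>2 ((Q + \<sigma> I) x - f)\<close> vanishes
  there, leaving only the second-order term.\<close>

lemma primal_shift_diff:
  fixes Q :: "real ^ 'n ^ 'n"
  assumes sym: "transpose Q = Q" and x: "(Q + \<sigma> *\<^sub>R mat 1) *v x = f"
  shows "primal Q f y + \<sigma> * (norm y)\<^sup>2 - (primal Q f x + \<sigma> * (norm x)\<^sup>2) =
    (y - x) \<bullet> ((Q + \<sigma> *\<^sub>R mat 1) *v (y - x))"
proof -
  have app: "(Q + \<sigma> *\<^sub>R mat 1) *v v = Q *v v + \<sigma> *\<^sub>R v" for v
    by (simp add: matrix_vector_mult_add_rdistrib scaleR_matrix_vector_assoc [symmetric])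
  have f: "f = Q *v x + \<sigma> *\<^sub>R x"
    using x by (simp add: app)
  \<comment> \<open>Symmetry of \<open>Q\<close> lets the two cross terms of the expansion be
    merged.\<close>
  have "y \<bullet> (Q *v x) = x \<bullet> (Q *v y)"
    by (metis dot_lmul_matrix inner_commute sym transpose_matrix_vector)
  then show ?thesis
    unfolding app primal_def f
    by (simp add: matrix_vector_mult_diff_distrib inner_add_left inner_diff_left inner_diff_right
        inner_add_right power2_norm_eq_inner inner_commute algebra_simps)
qed

section \<open>The secular function and where it attains \<open>r\<^sup>2\<close>\<close>

definition secular :: "nat \<Rightarrow> (nat \<Rightarrow> real) \<Rightarrow> (nat \<Rightarrow> real) \<Rightarrow> real \<Rightarrow> real" where
  "secular n c l \<sigma> = (\<Sum>i=1..n. c i / (l i + \<sigma>)\<^sup>2)"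

lemma secular_term_mono:
  fixes c l \<sigma> \<tau> :: real
  assumes "0 \<le> c" "0 < l + \<sigma>" "\<sigma> < \<tau>"
  shows "c / (l + \<tau>)\<^sup>2 \<le> c / (l + \<sigma>)\<^sup>2"
    and "c \<noteq> 0 \<Longrightarrow> c / (l + \<tau>)\<^sup>2 < c / (l + \<sigma>)\<^sup>2"
proof -
  have "(l + \<sigma>)\<^sup>2 < (l + \<tau>)\<^sup>2" "0 < (l + \<sigma>)\<^sup>2" "0 < (l + \<tau>)\<^sup>2"
    using assms by (auto intro: power_strict_mono)
  with assms(1) show "c / (l + \<tau>)\<^sup>2 \<le> c / (l + \<sigma>)\<^sup>2"
      "c \<noteq> 0 \<Longrightarrow> c / (l + \<tau>)\<^sup>2 < c / (l + \<sigma>)\<^sup>2"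
    by (simp_all add: divide_left_mono divide_strict_left_mono del: zero_less_power2)
qed

text \<open>A nonzero value at \<open>\<tau>\<close> forces some \<open>c j\<close> to be nonzero,
  and that summand decreases strictly. The index set is arbitrary because both the full sum and the
  tail over \<open>{k+1..n}\<close> are needed; the denominators of the tail stay positive even at
  \<open>- l 1\<close>.\<close>

lemma sum_secular_strict_antimono:
  fixes c l :: "nat \<Rightarrow> real"
  assumes "finite I" "\<And>i. i \<in> I \<Longrightarrow> 0 \<le> c i" "\<And>i. i \<in> I \<Longrightarrow> 0 < l i + \<sigma>" "\<sigma> < \<tau>"
    and nz: "(\<Sum>i\<in>I. c i / (l i + \<tau>)\<^sup>2) \<noteq> 0"
  shows "(\<Sum>i\<in>I. c i / (l i + \<tau>)\<^sup>2) < (\<Sum>i\<in>I. c i / (l i + \<sigma>)\<^sup>2)"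
proof -
  obtain j where "j \<in> I" "c j \<noteq> 0"
    using nz by (metis (no_types, lifting) div_0 sum.neutral)
  then show ?thesis
    using assms by (intro sum_strict_mono_ex1) (auto intro!: secular_term_mono)
qed

text \<open>There is a pole at \<open>- l 1\<close> exactly when some \<open>c i\<close> with
  \<open>i\<close> in \<open>{1..k}\<close> is nonzero. Otherwise only the tail over
  \<open>{k+1..n}\<close> remains; it is continuous at \<open>- l 1\<close>, and its value there is
  its supremum to the right.\<close>

lemma secular_attains_iff:
  fixes c l :: "nat \<Rightarrow> real"
  assumes r: "r > 0" and c: "\<And>i. 0 \<le> c i" and k: "1 \<le> k" "k \<le> n"
    and eq: "\<And>i. i \<in> {1..k} \<Longrightarrow> l i = l 1"
    and gt: "\<And>i. i \<in> {k+1..n} \<Longrightarrow> l 1 < l i"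
  shows "(\<exists>\<sigma>\<in>{- l 1<..}. secular n c l \<sigma> = r\<^sup>2) \<longleftrightarrow>
    (\<Sum>i=1..k. c i) \<noteq> 0 \<or> (\<Sum>i=k+1..n. c i / (l i - l 1)\<^sup>2) > r\<^sup>2"
proof -
  define T where "T \<sigma> = (\<Sum>i=k+1..n. c i / (l i + \<sigma>)\<^sup>2)" for \<sigma>
  have split: "secular n c l \<sigma> = (\<Sum>i=1..k. c i / (l i + \<sigma>)\<^sup>2) + T \<sigma>" for \<sigma>
  proof -
    have "{1..n} = {1..k} \<union> {k+1..n}" using k by auto
    then show ?thesis
      unfolding secular_def T_def by (simp add: sum.union_disjoint)
  qed
  have pos: "0 < l i + \<sigma>" if "i \<in> {1..n}" "\<sigma> > - l 1" for i \<sigma>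
  proof (cases "i \<le> k")
    case True
    then show ?thesis using eq [of i] that by simp
  next
    case False
    then show ?thesis using gt [of i] that by simp
  qed
  have T: "T (- l 1) = (\<Sum>i=k+1..n. c i / (l i - l 1)\<^sup>2)"
    by (simp add: T_def)
  show ?thesis
  proof
    assume "\<exists>\<sigma>\<in>{- l 1<..}. secular n c l \<sigma> = r\<^sup>2"
    then obtain \<sigma> where \<sigma>: "\<sigma> > - l 1" "secular n c l \<sigma> = r\<^sup>2" by auto
    have "(\<Sum>i=k+1..n. c i / (l i - l 1)\<^sup>2) > r\<^sup>2" if "(\<Sum>i=1..k. c i) = 0"
    proof -
      have "c i = 0" if "i \<in> {1..k}" for i
        using \<open>(\<Sum>i=1..k. c i) = 0\<close> c that by (simp add: sum_nonneg_eq_0_iff)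
      then have "T \<sigma> = r\<^sup>2"
        using \<sigma>(2) by (simp add: split)
      \<comment> \<open>Strict decrease is applied to the tail from the endpoint
        \<open>- l 1\<close> on; \<open>T \<sigma> = r\<^sup>2 > 0\<close> supplies the required
        nonzero value.\<close>
      then have "T \<sigma> < T (- l 1)"
        using \<sigma>(1) gt c r unfolding T_def
        by (intro sum_secular_strict_antimono) fastforce+
      then show ?thesis
        using \<open>T \<sigma> = r\<^sup>2\<close> T by simp
    qed
    then show "(\<Sum>i=1..k. c i) \<noteq> 0 \<or> (\<Sum>i=k+1..n. c i / (l i - l 1)\<^sup>2) > r\<^sup>2"
      by blast
  next
    assume cond: "(\<Sum>i=1..k. c i) \<noteq> 0 \<or> (\<Sum>i=k+1..n. c i / (l i - l 1)\<^sup>2) > r\<^sup>2"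
    \<comment> \<open>Such a point suffices for the intermediate value theorem, since the function
      tends to \<open>0\<close> at infinity.\<close>
    have "\<exists>a > - l 1. secular n c l a \<ge> r\<^sup>2"
    proof (cases "(\<Sum>i=1..k. c i) = 0")
      case False
      then obtain j where j: "j \<in> {1..k}" "c j \<noteq> 0"
        by (meson sum.neutral)
      then have cj: "0 < c j" using c [of j] by simp
      \<comment> \<open>chosen so that the \<open>j\<close>-th summand alone equals \<open>r\<^sup>2\<close>\<close>
      define a where "a = - l 1 + sqrt (c j) / r"
      have "r\<^sup>2 = c j / (l j + a)\<^sup>2"
        using cj r eq [OF j(1)] by (simp add: a_def power_divide)
      also have "\<dots> \<le> secular n c l a"
        unfolding secular_def using c j k
        by (intro member_le_sum [where f = "\<lambda>i. c i / (l i + a)\<^sup>2"]) auto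
      finally show ?thesis
        using cj r by (intro exI [of _ a]) (auto simp: a_def)
    next
      case True
      then have "r\<^sup>2 < T (- l 1)"
        using cond T by simp
      \<comment> \<open>The endpoint \<open>- l 1\<close> is itself excluded, so continuity carries
        the strict inequality to points on its right.\<close>
      moreover have "isCont T (- l 1)"
        unfolding T_def using gt by (intro continuous_intros) fastforce
      ultimately have "eventually (\<lambda>\<sigma>. r\<^sup>2 < T \<sigma>) (at_right (- l 1))"
        by (intro order_tendstoD(1)) (auto simp: isCont_def intro: filterlim_mono at_le)
      moreover have "eventually (\<lambda>\<sigma>. \<sigma> > - l 1) (at_right (- l 1))"
        by (rule eventually_at_right_less)
      ultimately have "eventually (\<lambda>\<sigma>. r\<^sup>2 < T \<sigma> \<and> \<sigma> > - l 1) (at_right (- l 1))"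
        by (rule eventually_conj)
      then obtain a where a: "r\<^sup>2 < T a" "a > - l 1"
        using eventually_happens' [OF trivial_limit_at_right_real] by blast
      have "T a \<le> secular n c l a"
        unfolding split using c by (simp add: sum_nonneg)
      with a show ?thesis by (intro exI [of _ a]) auto
    qed
    then obtain a where a: "a > - l 1" "secular n c l a \<ge> r\<^sup>2" by blast
    have "((\<lambda>\<sigma>. \<Sum>i=1..n. c i / (l i + \<sigma>)\<^sup>2) \<longlongrightarrow> (\<Sum>i=1..n. 0)) at_top"
      by (intro tendsto_sum tendsto_divide_0 [OF tendsto_const] filterlim_at_top_imp_at_infinity
          filterlim_pow_at_top filterlim_tendsto_add_at_top [OF tendsto_const] filterlim_ident) simp
    then have "(secular n c l \<longlongrightarrow> 0) at_top"
      by (simp add: secular_def [abs_def])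
    then have "eventually (\<lambda>\<sigma>. secular n c l \<sigma> < r\<^sup>2) at_top"
      using r by (intro order_tendstoD(2)) auto
    then obtain b where b: "b \<ge> a" "secular n c l b < r\<^sup>2"
      unfolding eventually_at_top_linorder by (meson nle_le)
    have "continuous_on {a..b} (secular n c l)"
    proof -
      have "(l i + x)\<^sup>2 \<noteq> 0" if "i \<in> {1..n}" "x \<in> {a..b}" for i x
        using pos [of i x] that a by force
      then show ?thesis
        unfolding secular_def [abs_def] by (intro continuous_intros) auto
    qed
    then obtain \<sigma> where "a \<le> \<sigma>" "secular n c l \<sigma> = r\<^sup>2"
      using IVT2' [of "secular n c l" b "r\<^sup>2" a] a b by auto
    then show "\<exists>\<sigma>\<in>{- l 1<..}. secular n c l \<sigma> = r\<^sup>2"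
      using a by auto
  qed
qed

section \<open>Critical points of the dual and global optimality\<close>

lemma critical_point_dual_iff:
  fixes Q U :: "real ^ 'n ^ 'n" and ix :: "nat \<Rightarrow> 'n"
  assumes bij: "bij_betw ix {1..CARD('n)} UNIV" and U: "orthogonal_matrix U"
    and Q: "Q = U ** diag_mat ix lam ** transpose U"
    and pos: "\<And>i \<tau>. \<lbrakk>i \<in> {1..CARD('n)}; \<tau> > m\<rbrakk> \<Longrightarrow> 0 < lam i + \<tau>"
    and \<sigma>: "\<sigma> > m"
  shows "critical_point (dual Q f r) \<sigma> \<longleftrightarrow>
    secular CARD('n) (\<lambda>i. ((transpose U *v f) $ ix i)\<^sup>2) lam \<sigma> = r\<^sup>2"
proof -
  define c where "c i = ((transpose U *v f) $ ix i)\<^sup>2" for i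
  let ?g = "\<lambda>\<tau>. - (\<Sum>i=1..CARD('n). inverse (lam i + \<tau>) * c i) - r\<^sup>2 * \<tau>"
  have nz: "lam i + \<tau> \<noteq> 0" if "i \<in> {1..CARD('n)}" "\<tau> > m" for i \<tau>
    using pos [OF that] by simp
  have dual: "dual Q f r \<tau> = ?g \<tau>" if "\<tau> > m" for \<tau>
    by (simp only: dual_def spectral_shift_inv(2) [OF bij U Q nz [OF _ that]]
        inner_spectral [OF bij] c_def)
  have "(?g has_real_derivative
      - (\<Sum>i=1..CARD('n). - (inverse (lam i + \<sigma>) * 1 * inverse (lam i + \<sigma>)) * c i) - r\<^sup>2) (at \<sigma>)"
    using nz [OF _ \<sigma>] by (auto intro!: derivative_eq_intros)
  also have "- (\<Sum>i=1..CARD('n). - (inverse (lam i + \<sigma>) * 1 * inverse (lam i + \<sigma>)) * c i) - r\<^sup>2 =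
      secular CARD('n) c lam \<sigma> - r\<^sup>2"
    by (simp add: secular_def sum_negf [symmetric] power2_eq_square divide_inverse mult_ac)
  \<comment> \<open>\<open>dual\<close> is known to agree with its spectral formula on
    \<open>{m<..}\<close>; this set is open, so the derivative at \<open>\<sigma>\<close> carries
    over.\<close>
  finally have "(dual Q f r has_real_derivative secular CARD('n) c lam \<sigma> - r\<^sup>2) (at \<sigma>)"
    by (rule has_field_derivative_transform_within_open [where S = "{m<..}"])
      (use \<sigma> dual in auto)
  then have "critical_point (dual Q f r) \<sigma> \<longleftrightarrow> secular CARD('n) c lam \<sigma> - r\<^sup>2 = 0"
    unfolding critical_point_def by (auto dest: DERIV_unique)
  then show ?thesis
    by (simp add: c_def [abs_def])
qed

theorem proposition3p1:
  fixes Q U :: "real ^ 'n ^ 'n"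
    and f fhat :: "real ^ 'n"
    and r :: real
    and ix :: "nat \<Rightarrow> 'n"
    and lam :: "nat \<Rightarrow> real"
    and k :: nat
  assumes "transpose Q = Q"
    and "r > 0"
    and "bij_betw ix {1..CARD('n)} UNIV"
    and "1 \<le> k" and "k \<le> CARD('n)"
    and "\<forall>i\<in>{1..k}. lam i = lam 1"
    and "k < CARD('n) \<longrightarrow> lam k < lam (k + 1)"
    and "mono_on {1..CARD('n)} lam"
    and "orthogonal_matrix U"
    and "Q = U ** diag_mat ix lam ** transpose U"
    and "fhat = transpose U *v f"
    and "\<exists>x. global_solution Q f r x \<and> norm x = r"
  shows "((\<exists>\<sigma>\<in>{- lam 1<..}. critical_point (dual Q f r) \<sigma>) \<longleftrightarrow>
            (\<Sum>i=1..k. (fhat $ ix i)\<^sup>2) \<noteq> 0 \<or>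
            (\<Sum>i=k+1..CARD('n). (fhat $ ix i)\<^sup>2 / (lam i - lam 1)\<^sup>2) > r\<^sup>2) \<and>
         (\<forall>\<sigma>\<in>{- lam 1<..}. critical_point (dual Q f r) \<sigma> \<longrightarrow>
            (\<forall>\<tau>\<in>{- lam 1<..}. critical_point (dual Q f r) \<tau> \<longrightarrow> \<tau> = \<sigma>) \<and>
            global_solution Q f r (matrix_inv (Q + \<sigma> *\<^sub>R mat 1) *v f))"
proof -
  define N where "N = CARD('n)"
  define c where "c i = (fhat $ ix i)\<^sup>2" for i
  note bij = assms(3) and U = assms(9) and Q = assms(10)
  have c: "0 \<le> c i" for i
    by (simp add: c_def)
  have eq: "lam i = lam 1" if "i \<in> {1..k}" for i
    using assms(6) that by blast
  \<comment> \<open>Monotonicity passes the gap after \<open>lam k\<close> on to all later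
    indices.\<close>
  have gt: "lam 1 < lam i" if "i \<in> {k+1..N}" for i
  proof -
    have "lam (k + 1) \<le> lam i"
      using mono_onD [OF assms(8), of "k + 1" i] that by (simp add: N_def)
    moreover have "lam 1 = lam k"
      using eq [of k] assms(4) by simp
    ultimately show ?thesis
      using assms(7) that by (simp add: N_def)
  qed
  have pos: "0 < lam i + \<tau>" if "i \<in> {1..CARD('n)}" "\<tau> > - lam 1" for i \<tau>
    using mono_onD [OF assms(8), of 1 i] that by simp
  have crit: "critical_point (dual Q f r) \<sigma> \<longleftrightarrow> secular N c lam \<sigma> = r\<^sup>2" if "\<sigma> > - lam 1" for \<sigma>
    using critical_point_dual_iff [OF bij U Q pos that]
    by (simp add: N_def c_def [abs_def] assms(11))
  have "(\<exists>\<sigma>\<in>{- lam 1<..}. critical_point (dual Q f r) \<sigma>) \<longleftrightarrow>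
      (\<Sum>i=1..k. c i) \<noteq> 0 \<or> (\<Sum>i=k+1..N. c i / (lam i - lam 1)\<^sup>2) > r\<^sup>2"
  proof -
    have "(\<exists>\<sigma>\<in>{- lam 1<..}. secular N c lam \<sigma> = r\<^sup>2) \<longleftrightarrow>
        (\<Sum>i=1..k. c i) \<noteq> 0 \<or> (\<Sum>i=k+1..N. c i / (lam i - lam 1)\<^sup>2) > r\<^sup>2"
      by (intro secular_attains_iff c gt assms(2,4)) (erule eq | simp add: N_def assms(5))+
    then show ?thesis
      using crit by simp
  qed
  moreover have "\<tau> = \<sigma>"
    if "\<sigma> > - lam 1" "\<tau> > - lam 1" "secular N c lam \<sigma> = r\<^sup>2" "secular N c lam \<tau> = r\<^sup>2" for \<sigma> \<tau>
  proof -
    \<comment> \<open>Equal values at ordered points contradict strict decrease, as the common value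
      \<open>r\<^sup>2\<close> is nonzero. The claim is then used in both orders.\<close>
    have "\<not> \<sigma> < \<tau>"
      if "\<sigma> > - lam 1" "secular N c lam \<sigma> = r\<^sup>2" "secular N c lam \<tau> = r\<^sup>2" for \<sigma> \<tau>
      using sum_secular_strict_antimono [of "{1..N}" c lam \<sigma> \<tau>] c pos that assms(2)
      by (auto simp: N_def secular_def)
    then show ?thesis
      using that by (meson linorder_neqE_linordered_idom)
  qed
  moreover have "global_solution Q f r (matrix_inv (Q + \<sigma> *\<^sub>R mat 1) *v f)"
    if \<sigma>: "\<sigma> > - lam 1" and sec: "secular N c lam \<sigma> = r\<^sup>2" for \<sigma>
  proof -
    obtain x0 where x0: "norm x0 = r" "\<And>y. norm y \<le> r \<Longrightarrow> primal Q f x0 \<le> primal Q f y"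
      using assms(12) by (auto simp: global_solution_def is_arg_min_linorder)
    define x where "x = matrix_inv (Q + \<sigma> *\<^sub>R mat 1) *v f"
    have nz: "lam i + \<sigma> \<noteq> 0" if "i \<in> {1..CARD('n)}" for i
      using pos [OF that \<sigma>] by simp
    note inv = spectral_shift_inv [OF bij U Q nz]
    have "(norm x)\<^sup>2 = secular N c lam \<sigma>"
      by (simp only: x_def inv(2) norm_spectral [OF bij U] secular_def c_def N_def assms(11)
          power_inverse divide_inverse mult.commute)
    \<comment> \<open>Criticality enters here: it puts \<open>x\<close> on the same sphere as
      \<open>x0\<close>.\<close>
    then have norm: "norm x = r"
      using sec assms(2) by (simp add: power2_eq_iff_nonneg)
    have "(Q + \<sigma> *\<^sub>R mat 1) *v x = f"
      by (simp only: x_def inv matrix_vector_mul_assoc matrix_vector_mul_lid)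
    then have "primal Q f x0 + \<sigma> * (norm x0)\<^sup>2 - (primal Q f x + \<sigma> * (norm x)\<^sup>2) =
        (x0 - x) \<bullet> ((Q + \<sigma> *\<^sub>R mat 1) *v (x0 - x))"
      by (rule primal_shift_diff [OF assms(1)])
    \<comment> \<open>In eigenvector coordinates the form is a sum of squares with the positive
      weights \<open>lam i + \<sigma>\<close>.\<close>
    also have "\<dots> \<ge> 0"
      unfolding Q orthogonal_conj_shift [OF U] diag_mat_shift inner_spectral [OF bij]
      using pos \<sigma> by (intro sum_nonneg mult_nonneg_nonneg) (auto intro: less_imp_le)
    \<comment> \<open>Both norms equal \<open>r\<close>, so the terms with \<open>\<sigma>\<close>
      cancel. As \<open>x0\<close> is minimal on the whole ball, so is the feasible point
      \<open>x\<close>.\<close>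
    finally have "primal Q f x \<le> primal Q f x0"
      by (simp add: norm x0(1))
    then have "global_solution Q f r x"
      using x0(2) norm by (force simp: global_solution_def is_arg_min_linorder)
    then show ?thesis
      by (simp add: x_def)
  qed
  ultimately show ?thesis
    using crit by (simp add: N_def c_def)
qed

end
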